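(* Let $a\in L^1(I)$. Then $$\Lambda_N[a,T]\cup\Lambda_D[a,T]=\Lambda_P[\tilde a,2T],$$ $$\Lambda_N[a,T]\subset\Lambda_N[\tilde a,2T],\qquad \Lambda_D[a,T]\subset\Lambda_D[\tilde a,2T],$$ and $$\Lambda_N[a,T]\cup\Lambda_D[a,T]\subset\Lambda_N[\tilde a,2T]\cup\Lambda_D[\tilde a,2T]=\Lambda_P[\tilde{\tilde a},4T].$$
   Context: Fix $T>0$ and put $I=[0,T]$. For $a\in L^1(I)$, $\tilde a$ is its even extension to $[0,2T]$: $\tilde a(t)=a(t)$ on $[0,T]$, $\tilde a(t)=a(2T-t)$ on $(T,2T]$; and $\tilde{\tilde a}$ is the even extension of $\tilde a$ to $[0,4T]$: $\tilde{\tilde a}(t)=\tilde a(t)$ on $[0,2T]$, $\tilde{\tilde a}(t)=\tilde a(4T-t)$ on $(2T,4T]$. For $S>0$ and $q\in L^1(0,S)$, $\Lambda_B[q,S]$ denotes the set of $\lambda\in\mathbb{R}$ such that $u''(t)+(q(t)+\lambda)u(t)=0$ for a.e. $t\in[0,S]$ has a nontrivial solution $u\in C^1[0,S]$ with $u'$ absolutely continuous satisfying the boundary condition $B$, where: $B=P$ (periodic): $u(0)=u(S)$, $u'(0)=u'(S)$; $B=N$ (Neumann): $u'(0)=u'(S)=0$; $B=D$ (Dirichlet): $u(0)=u(S)=0$. *)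

theory Defs
  imports "HOL-Analysis.Analysis"
begin

(* Only the values on {0..2 * S} matter. *)
definition even_ext :: "real \<Rightarrow> (real \<Rightarrow> real) \<Rightarrow> real \<Rightarrow> real" where
  "even_ext S a = (\<lambda>t. if t \<le> S then a t else a (2 * S - t))"

(* Absolute continuity of a function on an interval J, by the usual epsilon-delta condition over
   finite families of non-overlapping compact subintervals {l i..r i}. The library constant
   absolutely_continuous is about measures. *)
definition abs_continuous_on :: "real set \<Rightarrow> (real \<Rightarrow> real) \<Rightarrow> bool" where
  "abs_continuous_on J f \<longleftrightarrow>
     (\<forall>\<epsilon>>0. \<exists>\<delta>>0. \<forall>(n::nat) (l::nat \<Rightarrow> real) (r::nat \<Rightarrow> real).
        (\<forall>i<n. l i \<le> r i \<and> {l i..r i} \<subseteq> J) \<and>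
        pairwise (\<lambda>i j. {l i<..<r i} \<inter> {l j<..<r j} = {}) {..<n} \<and>
        (\<Sum>i<n. r i - l i) < \<delta>
        \<longrightarrow> (\<Sum>i<n. \<bar>f (r i) - f (l i)\<bar>) < \<epsilon>)"

(* u is a solution on {0..S}, in the Caratheodory sense, and u' is its derivative there
   (one-sided at the end points). *)
definition hill_solution ::
    "(real \<Rightarrow> real) \<Rightarrow> real \<Rightarrow> real \<Rightarrow> (real \<Rightarrow> real) \<Rightarrow> (real \<Rightarrow> real) \<Rightarrow> bool" where
  "hill_solution q S \<mu> u u' \<longleftrightarrow>
     (\<forall>t\<in>{0..S}. (u has_real_derivative u' t) (at t within {0..S})) \<and>
     continuous_on {0..S} u' \<and>
     abs_continuous_on {0..S} u' \<and>
     (AE t\<in>{0..S} in lebesgue. \<exists>u''. (u' has_real_derivative u'') (at t within {0..S}) \<and>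
        u'' + (q t + \<mu>) * u t = 0)"

datatype boundary = Periodic | Neumann | Dirichlet

fun boundary_condition ::
    "boundary \<Rightarrow> real \<Rightarrow> (real \<Rightarrow> real) \<Rightarrow> (real \<Rightarrow> real) \<Rightarrow> bool" where
  "boundary_condition Periodic S u u' \<longleftrightarrow> u 0 = u S \<and> u' 0 = u' S"
| "boundary_condition Neumann S u u' \<longleftrightarrow> u' 0 = 0 \<and> u' S = 0"
| "boundary_condition Dirichlet S u u' \<longleftrightarrow> u 0 = 0 \<and> u S = 0"

definition spectrum :: "boundary \<Rightarrow> (real \<Rightarrow> real) \<Rightarrow> real \<Rightarrow> real set" where
  "spectrum B q S =
     {\<mu>. \<exists>u u'. hill_solution q S \<mu> u u' \<and> boundary_condition B S u u' \<and>
           (\<exists>t\<in>{0..S}. u t \<noteq> 0)}"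

end

theory Submission
  imports Defs
begin

text \<open>
  The extended coefficient satisfies \<open>q (2 * S - t) = q t\<close>, so reflection in the midpoint \<open>S\<close>
  maps solutions on \<open>{0..2 * S}\<close> to solutions. If \<open>u\<close> is a periodic solution, then
  \<open>u t + u (2 * S - t)\<close> has derivative \<open>0\<close> at both \<open>0\<close> (by periodicity) and \<open>S\<close> (by symmetry), and
  \<open>u t - u (2 * S - t)\<close> likewise vanishes at \<open>0\<close> and \<open>S\<close>. These functions restrict to a Neumann and
  a Dirichlet solution on \<open>{0..S}\<close>, and they cannot both be zero because their sum is \<open>2 * u\<close>
  (\<open>spectrum_Periodic_subset\<close>).

  Conversely, a Neumann solution on \<open>{0..S}\<close> extends evenly, and a Dirichlet solution oddly, about
  \<open>S\<close>. The boundary condition at \<open>S\<close> is exactly what makes the two halves fit together in \<open>C\<^sup>1\<close>, and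
  the one at \<open>0\<close> is copied to \<open>2 * S\<close>; so the extension is periodic and satisfies the original
  condition as well (\<open>hill_solution_extend\<close>).

  The inclusions and the first equality are these two facts for \<open>S = T\<close>; the last equality is the
  first one for \<open>S = 2 * T\<close> and the extended coefficient. The analytic
  point is that reflecting, adding and gluing preserve absolute continuity of the derivative
  (\<open>abs_continuous_on_reflect\<close>, \<open>abs_continuous_on_add\<close>, \<open>abs_continuous_on_Un\<close>).
\<close>

section \<open>Absolutely continuous functions\<close>

definition nonoverlapping_in :: "real set \<Rightarrow> nat \<Rightarrow> (nat \<Rightarrow> real) \<Rightarrow> (nat \<Rightarrow> real) \<Rightarrow> bool" where
  "nonoverlapping_in J n l r \<longleftrightarrow> (\<forall>i<n. l i \<le> r i \<and> {l i..r i} \<subseteq> J) \<and>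
     pairwise (\<lambda>i j. {l i<..<r i} \<inter> {l j<..<r j} = {}) {..<n}"

lemma nonoverlapping_inI:
  assumes "\<And>i. i < n \<Longrightarrow> l i \<le> r i" "\<And>i. i < n \<Longrightarrow> {l i..r i} \<subseteq> J"
    and "\<And>i j x. \<lbrakk>i < n; j < n; i \<noteq> j; x \<in> {l i<..<r i}; x \<in> {l j<..<r j}\<rbrakk> \<Longrightarrow> False"
  shows "nonoverlapping_in J n l r"
  unfolding nonoverlapping_in_def pairwise_def using assms by (metis disjoint_iff lessThan_iff)

lemma nonoverlapping_inD:
  assumes "nonoverlapping_in J n l r" "i < n"
  shows "l i \<le> r i" "{l i..r i} \<subseteq> J" "l i \<in> J" "r i \<in> J"
    and "\<lbrakk>j < n; i \<noteq> j; x \<in> {l i<..<r i}\<rbrakk> \<Longrightarrow> x \<notin> {l j<..<r j}"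
proof -
  show lr: "l i \<le> r i" "{l i..r i} \<subseteq> J"
    using assms by (simp_all add: nonoverlapping_in_def)
  show "l i \<in> J" "r i \<in> J"
    using lr by auto
  assume "j < n" "i \<noteq> j" "x \<in> {l i<..<r i}"
  moreover from this assms have "{l i<..<r i} \<inter> {l j<..<r j} = {}"
    by (simp add: nonoverlapping_in_def pairwise_def)
  ultimately show "x \<notin> {l j<..<r j}" by blast
qed

lemma nonoverlapping_in_mono:
  "\<lbrakk>nonoverlapping_in K n l r; K \<subseteq> J\<rbrakk> \<Longrightarrow> nonoverlapping_in J n l r"
  unfolding nonoverlapping_in_def by (meson order_trans)

lemma abs_continuous_on_iff:
  "abs_continuous_on J f \<longleftrightarrow> (\<forall>\<epsilon>>0. \<exists>\<delta>>0. \<forall>n l r.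
     nonoverlapping_in J n l r \<and> (\<Sum>i<n. r i - l i) < \<delta> \<longrightarrow> (\<Sum>i<n. \<bar>f (r i) - f (l i)\<bar>) < \<epsilon>)"
  unfolding abs_continuous_on_def nonoverlapping_in_def conj_assoc ..

lemma abs_continuous_onE:
  assumes "abs_continuous_on J f" "\<epsilon> > 0"
  obtains \<delta> where "\<delta> > 0"
    "\<forall>n l r. nonoverlapping_in J n l r \<and> (\<Sum>i<n. r i - l i) < \<delta> \<longrightarrow> (\<Sum>i<n. \<bar>f (r i) - f (l i)\<bar>) < \<epsilon>"
  using assms(1)[unfolded abs_continuous_on_iff, rule_format, OF assms(2)]
  by (elim exE conjE) (rule that)

lemma abs_continuous_onI:
  assumes "\<And>\<epsilon>. \<epsilon> > 0 \<Longrightarrow> \<exists>\<delta>>0. \<forall>n l r.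
    nonoverlapping_in J n l r \<and> (\<Sum>i<n. r i - l i) < \<delta> \<longrightarrow> (\<Sum>i<n. \<bar>f (r i) - f (l i)\<bar>) < \<epsilon>"
  shows "abs_continuous_on J f"
  unfolding abs_continuous_on_iff by (intro allI impI) (rule assms)

lemma abs_continuous_on_subset:
  assumes "abs_continuous_on J f" "K \<subseteq> J"
  shows "abs_continuous_on K f"
proof (rule abs_continuous_onI)
  fix \<epsilon> :: real assume "\<epsilon> > 0"
  from assms(1) this obtain \<delta> where "\<delta> > 0"
    "\<forall>n l r. nonoverlapping_in J n l r \<and> (\<Sum>i<n. r i - l i) < \<delta> \<longrightarrow> (\<Sum>i<n. \<bar>f (r i) - f (l i)\<bar>) < \<epsilon>"
    by (rule abs_continuous_onE) (rule that)
  then show "\<exists>\<delta>>0. \<forall>n l r. nonoverlapping_in K n l r \<and> (\<Sum>i<n. r i - l i) < \<delta> \<longrightarrow>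
      (\<Sum>i<n. \<bar>f (r i) - f (l i)\<bar>) < \<epsilon>"
    using nonoverlapping_in_mono[OF _ assms(2)] by (intro exI[of _ \<delta>]) simp
qed

lemma abs_continuous_on_cong:
  assumes "abs_continuous_on J f" "\<And>t. t \<in> J \<Longrightarrow> g t = f t"
  shows "abs_continuous_on J g"
proof (rule abs_continuous_onI)
  fix \<epsilon> :: real assume "\<epsilon> > 0"
  from assms(1) this obtain \<delta> where d: "\<delta> > 0"
    "\<forall>n l r. nonoverlapping_in J n l r \<and> (\<Sum>i<n. r i - l i) < \<delta> \<longrightarrow> (\<Sum>i<n. \<bar>f (r i) - f (l i)\<bar>) < \<epsilon>"
    by (rule abs_continuous_onE) (rule that)
  have "(\<Sum>i<n. \<bar>g (r i) - g (l i)\<bar>) = (\<Sum>i<n. \<bar>f (r i) - f (l i)\<bar>)" if "nonoverlapping_in J n l r" for n l r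
    by (rule sum.cong) (use nonoverlapping_inD[OF that] assms(2) in auto)
  with d show "\<exists>\<delta>>0. \<forall>n l r. nonoverlapping_in J n l r \<and> (\<Sum>i<n. r i - l i) < \<delta> \<longrightarrow>
      (\<Sum>i<n. \<bar>g (r i) - g (l i)\<bar>) < \<epsilon>"
    by (intro exI[of _ \<delta>]) simp
qed

lemma abs_continuous_on_add:
  assumes "abs_continuous_on J f" "abs_continuous_on J g"
  shows "abs_continuous_on J (\<lambda>t. f t + g t)"
proof (rule abs_continuous_onI)
  fix \<epsilon> :: real assume "\<epsilon> > 0"
  then have e2: "\<epsilon> / 2 > 0" by simp
  from assms(1) e2 obtain \<delta>\<^sub>f where f: "\<delta>\<^sub>f > 0"
    "\<forall>n l r. nonoverlapping_in J n l r \<and> (\<Sum>i<n. r i - l i) < \<delta>\<^sub>f \<longrightarrow> (\<Sum>i<n. \<bar>f (r i) - f (l i)\<bar>) < \<epsilon> / 2"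
    by (rule abs_continuous_onE) (rule that)
  from assms(2) e2 obtain \<delta>\<^sub>g where g: "\<delta>\<^sub>g > 0"
    "\<forall>n l r. nonoverlapping_in J n l r \<and> (\<Sum>i<n. r i - l i) < \<delta>\<^sub>g \<longrightarrow> (\<Sum>i<n. \<bar>g (r i) - g (l i)\<bar>) < \<epsilon> / 2"
    by (rule abs_continuous_onE) (rule that)
  have "(\<Sum>i<n. \<bar>f (r i) + g (r i) - (f (l i) + g (l i))\<bar>) < \<epsilon>"
    if "nonoverlapping_in J n l r" "(\<Sum>i<n. r i - l i) < min \<delta>\<^sub>f \<delta>\<^sub>g" for n l r
  proof -
    have "(\<Sum>i<n. \<bar>f (r i) + g (r i) - (f (l i) + g (l i))\<bar>)
        \<le> (\<Sum>i<n. \<bar>f (r i) - f (l i)\<bar> + \<bar>g (r i) - g (l i)\<bar>)"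
      by (rule sum_mono) linarith
    with f(2)[rule_format, of n l r] g(2)[rule_format, of n l r] that show ?thesis
      by (simp add: sum.distrib)
  qed
  with f(1) g(1) show "\<exists>\<delta>>0. \<forall>n l r. nonoverlapping_in J n l r \<and> (\<Sum>i<n. r i - l i) < \<delta> \<longrightarrow>
      (\<Sum>i<n. \<bar>f (r i) + g (r i) - (f (l i) + g (l i))\<bar>) < \<epsilon>"
    by (intro exI[of _ "min \<delta>\<^sub>f \<delta>\<^sub>g"]) simp
qed

lemma abs_continuous_on_reflect:
  fixes m c :: real
  assumes "abs_continuous_on {a..b} f"
  shows "abs_continuous_on {m - b..m - a} (\<lambda>t. c * f (m - t))"
proof (rule abs_continuous_onI)
  fix \<epsilon> :: real assume "\<epsilon> > 0"
  \<comment> \<open>The \<open>+ 1\<close> covers \<open>c = 0\<close>.\<close>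
  then have "\<epsilon> / (\<bar>c\<bar> + 1) > 0" by simp
  with assms obtain \<delta> where d: "\<delta> > 0"
    "\<forall>n l r. nonoverlapping_in {a..b} n l r \<and> (\<Sum>i<n. r i - l i) < \<delta> \<longrightarrow>
      (\<Sum>i<n. \<bar>f (r i) - f (l i)\<bar>) < \<epsilon> / (\<bar>c\<bar> + 1)"
    by (rule abs_continuous_onE) (rule that)
  have "(\<Sum>i<n. \<bar>c * f (m - r i) - c * f (m - l i)\<bar>) < \<epsilon>"
    if lr: "nonoverlapping_in {m - b..m - a} n l r" "(\<Sum>i<n. r i - l i) < \<delta>" for n l r
  proof -
    have "nonoverlapping_in {a..b} n (\<lambda>i. m - r i) (\<lambda>i. m - l i)"
    proof (rule nonoverlapping_inI)
      fix i assume i: "i < n"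
      show "m - r i \<le> m - l i" "{m - r i..m - l i} \<subseteq> {a..b}"
        using nonoverlapping_inD[OF lr(1) i] by auto
      fix j x assume "j < n" "i \<noteq> j" "x \<in> {m - r i<..<m - l i}" "x \<in> {m - r j<..<m - l j}"
      then show False
        using nonoverlapping_inD(5)[OF lr(1) i, of j "m - x"] by auto
    qed
    from this lr(2) d(2)[rule_format, of n "\<lambda>i. m - r i" "\<lambda>i. m - l i"]
    have S: "(\<Sum>i<n. \<bar>f (m - l i) - f (m - r i)\<bar>) < \<epsilon> / (\<bar>c\<bar> + 1)" by simp
    have "\<bar>c * x - c * y\<bar> = \<bar>c\<bar> * \<bar>y - x\<bar>" for x y
      by (metis abs_minus_commute abs_mult right_diff_distrib)
    then have "(\<Sum>i<n. \<bar>c * f (m - r i) - c * f (m - l i)\<bar>) = \<bar>c\<bar> * (\<Sum>i<n. \<bar>f (m - l i) - f (m - r i)\<bar>)"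
      by (simp add: sum_distrib_left)
    also have "\<dots> \<le> (\<bar>c\<bar> + 1) * (\<Sum>i<n. \<bar>f (m - l i) - f (m - r i)\<bar>)"
      by (intro mult_right_mono sum_nonneg) auto
    also have "\<dots> < \<epsilon>"
      using S by (simp add: pos_less_divide_eq mult.commute)
    finally show ?thesis .
  qed
  with d(1) show "\<exists>\<delta>>0. \<forall>n l r. nonoverlapping_in {m - b..m - a} n l r \<and> (\<Sum>i<n. r i - l i) < \<delta> \<longrightarrow>
      (\<Sum>i<n. \<bar>c * f (m - r i) - c * f (m - l i)\<bar>) < \<epsilon>"
    by (intro exI[of _ \<delta>]) simp
qed

text \<open>
  An interval that straddles \<open>b\<close> has to be cut there. Replacing \<open>{l..r}\<close> by its two truncations
  \<open>{min l b..min r b}\<close> and \<open>{max l b..max r b}\<close> does this without a case distinction: an interval on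
  one side of \<open>b\<close> merely acquires a degenerate companion.
\<close>

lemma abs_continuous_on_Un:
  assumes "abs_continuous_on {a..b} f" "abs_continuous_on {b..c} f" "a \<le> b" "b \<le> c"
  shows "abs_continuous_on {a..c} f"
proof (rule abs_continuous_onI)
  fix \<epsilon> :: real assume "\<epsilon> > 0"
  then have e2: "\<epsilon> / 2 > 0" by simp
  from assms(1) e2 obtain \<delta>\<^sub>1 where d1: "\<delta>\<^sub>1 > 0"
    "\<forall>n l r. nonoverlapping_in {a..b} n l r \<and> (\<Sum>i<n. r i - l i) < \<delta>\<^sub>1 \<longrightarrow> (\<Sum>i<n. \<bar>f (r i) - f (l i)\<bar>) < \<epsilon> / 2"
    by (rule abs_continuous_onE) (rule that)
  from assms(2) e2 obtain \<delta>\<^sub>2 where d2: "\<delta>\<^sub>2 > 0"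
    "\<forall>n l r. nonoverlapping_in {b..c} n l r \<and> (\<Sum>i<n. r i - l i) < \<delta>\<^sub>2 \<longrightarrow> (\<Sum>i<n. \<bar>f (r i) - f (l i)\<bar>) < \<epsilon> / 2"
    by (rule abs_continuous_onE) (rule that)
  have "(\<Sum>i<n. \<bar>f (r i) - f (l i)\<bar>) < \<epsilon>"
    if non: "nonoverlapping_in {a..c} n l r" and small: "(\<Sum>i<n. r i - l i) < min \<delta>\<^sub>1 \<delta>\<^sub>2" for n l r
  proof -
    have lr: "l i \<le> r i" "a \<le> l i" "r i \<le> c" if "i < n" for i
      using nonoverlapping_inD[OF non that] by auto
    have disj: False if "i < n" "j < n" "i \<noteq> j" "l i < x" "x < r i" "l j < x" "x < r j" for i j x
      using nonoverlapping_inD(5)[OF non, of i j x] that by auto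
    have left: "nonoverlapping_in {a..b} n (\<lambda>i. min (l i) b) (\<lambda>i. min (r i) b)"
    proof (rule nonoverlapping_inI)
      fix i assume i: "i < n"
      show "min (l i) b \<le> min (r i) b" "{min (l i) b..min (r i) b} \<subseteq> {a..b}"
        using lr[OF i] assms(3) by auto
      fix j x assume "j < n" "i \<noteq> j"
        "x \<in> {min (l i) b<..<min (r i) b}" "x \<in> {min (l j) b<..<min (r j) b}"
      then show False
        by (intro disj[OF i, of j x]) (auto simp: min_less_iff_disj less_max_iff_disj)
    qed
    have right: "nonoverlapping_in {b..c} n (\<lambda>i. max (l i) b) (\<lambda>i. max (r i) b)"
    proof (rule nonoverlapping_inI)
      fix i assume i: "i < n"
      show "max (l i) b \<le> max (r i) b" "{max (l i) b..max (r i) b} \<subseteq> {b..c}"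
        using lr[OF i] assms(4) by auto
      fix j x assume "j < n" "i \<noteq> j"
        "x \<in> {max (l i) b<..<max (r i) b}" "x \<in> {max (l j) b<..<max (r j) b}"
      then show False
        by (intro disj[OF i, of j x]) (auto simp: min_less_iff_disj less_max_iff_disj)
    qed
    have "(\<Sum>i<n. min (r i) b - min (l i) b) \<le> (\<Sum>i<n. r i - l i)"
      "(\<Sum>i<n. max (r i) b - max (l i) b) \<le> (\<Sum>i<n. r i - l i)"
      by (rule sum_mono; use lr in \<open>fastforce simp: min_def max_def\<close>)+
    then have "(\<Sum>i<n. \<bar>f (min (r i) b) - f (min (l i) b)\<bar>) < \<epsilon> / 2"
      "(\<Sum>i<n. \<bar>f (max (r i) b) - f (max (l i) b)\<bar>) < \<epsilon> / 2"
      using d1(2)[rule_format, OF conjI[OF left]] d2(2)[rule_format, OF conjI[OF right]] small by linarith+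
    moreover have "(\<Sum>i<n. \<bar>f (r i) - f (l i)\<bar>)
        \<le> (\<Sum>i<n. \<bar>f (min (r i) b) - f (min (l i) b)\<bar> + \<bar>f (max (r i) b) - f (max (l i) b)\<bar>)"
      by (rule sum_mono) (auto simp: min_def max_def)
    ultimately show ?thesis
      by (simp add: sum.distrib)
  qed
  with d1(1) d2(1) show "\<exists>\<delta>>0. \<forall>n l r. nonoverlapping_in {a..c} n l r \<and> (\<Sum>i<n. r i - l i) < \<delta> \<longrightarrow>
      (\<Sum>i<n. \<bar>f (r i) - f (l i)\<bar>) < \<epsilon>"
    by (intro exI[of _ "min \<delta>\<^sub>1 \<delta>\<^sub>2"]) simp
qed

section \<open>Operations on solutions\<close>

lemma AE_lebesgue_reflect:
  fixes m :: real
  assumes "AE t in lebesgue. P t"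
  shows "AE t in lebesgue. P (m - t)"
proof -
  obtain N where N: "\<And>t. t \<in> space lebesgue - N \<Longrightarrow> P t" "N \<in> null_sets lebesgue"
    using AE_E3[OF assms] by blast
  have "negligible N"
    using N(2) by (simp add: negligible_iff_null_sets)
  then have "negligible ((\<lambda>t. m - t) ` N)"
    by (intro negligible_differentiable_image_negligible) (auto intro!: derivative_intros)
  moreover have "{t. \<not> P (m - t)} \<subseteq> (\<lambda>t. m - t) ` N"
  proof
    fix t assume "t \<in> {t. \<not> P (m - t)}"
    then have "m - t \<in> N" using N(1) by auto
    then show "t \<in> (\<lambda>t. m - t) ` N" by (intro image_eqI[of _ _ "m - t"]) auto
  qed
  ultimately show ?thesis
    by (intro AE_I'[of "(\<lambda>t. m - t) ` N"]) (auto simp: negligible_iff_null_sets)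
qed

lemma has_real_derivative_reflect:
  fixes m c :: real
  assumes "(f has_real_derivative D) (at (m - t) within {a..b})"
  shows "((\<lambda>t. c * f (m - t)) has_real_derivative - c * D) (at t within {m - b..m - a})"
proof -
  have im: "(\<lambda>t. m - t) ` {m - b..m - a} = {a..b}"
    by simp
  have "((\<lambda>t. m - t) has_real_derivative - 1) (at t within {m - b..m - a})"
    by (auto intro!: derivative_eq_intros)
  from DERIV_cmult[OF DERIV_image_chain[OF assms[folded im] this], of c] show ?thesis
    by (simp add: o_def)
qed

lemma has_real_derivative_Un:
  assumes "t \<in> A \<Longrightarrow> (f has_real_derivative D) (at t within A)"
    and "t \<in> B \<Longrightarrow> (f has_real_derivative D) (at t within B)"
    and "closed A" "closed B"
  shows "(f has_real_derivative D) (at t within A \<union> B)"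
proof -
  have *: "(f has_real_derivative D) (at t within X)"
    if "t \<in> X \<Longrightarrow> (f has_real_derivative D) (at t within X)" "closed X" for X
  proof (cases "t \<in> X")
    case False
    then have "at t within X = bot"
      using \<open>closed X\<close> by (metis at_within_eq_bot_iff Diff_empty Diff_insert0 closure_closed)
    then show ?thesis by (simp add: has_field_derivative_iff)
  qed (use that in simp)
  from *[OF assms(1) assms(3)] *[OF assms(2) assms(4)] show ?thesis
    by (simp add: has_field_derivative_iff Lim_within_Un)
qed

text \<open>Gluing at the midpoint needs solutions on the right half \<open>{S..2 * S}\<close>, which does not start at
  \<open>0\<close>; hence the version for an arbitrary interval.\<close>

definition hill_solution_on ::
    "real set \<Rightarrow> (real \<Rightarrow> real) \<Rightarrow> real \<Rightarrow> (real \<Rightarrow> real) \<Rightarrow> (real \<Rightarrow> real) \<Rightarrow> bool" where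
  "hill_solution_on J q \<mu> u u' \<longleftrightarrow>
     (\<forall>t\<in>J. (u has_real_derivative u' t) (at t within J)) \<and>
     continuous_on J u' \<and>
     abs_continuous_on J u' \<and>
     (AE t\<in>J in lebesgue. \<exists>u''. (u' has_real_derivative u'') (at t within J) \<and>
        u'' + (q t + \<mu>) * u t = 0)"

lemma hill_solution_iff_on: "hill_solution q S \<mu> u u' \<longleftrightarrow> hill_solution_on {0..S} q \<mu> u u'"
  unfolding hill_solution_def hill_solution_on_def ..

lemma hill_solution_on_subset:
  assumes "hill_solution_on J q \<mu> u u'" "K \<subseteq> J"
  shows "hill_solution_on K q \<mu> u u'"
  unfolding hill_solution_on_def
proof (intro conjI ballI)
  show "(u has_real_derivative u' t) (at t within K)" if "t \<in> K" for t
    using assms that unfolding hill_solution_on_def by (meson DERIV_subset subsetD)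
  show "continuous_on K u'"
    using assms unfolding hill_solution_on_def by (meson continuous_on_subset)
  show "abs_continuous_on K u'"
    using assms unfolding hill_solution_on_def by (meson abs_continuous_on_subset)
  have "AE t\<in>J in lebesgue. \<exists>u''. (u' has_real_derivative u'') (at t within J) \<and>
        u'' + (q t + \<mu>) * u t = 0"
    using assms unfolding hill_solution_on_def by simp
  then show "AE t\<in>K in lebesgue. \<exists>u''. (u' has_real_derivative u'') (at t within K) \<and>
        u'' + (q t + \<mu>) * u t = 0"
    by eventually_elim (use assms(2) in \<open>meson DERIV_subset subsetD\<close>)
qed

lemma hill_solution_on_cong:
  assumes "hill_solution_on J q \<mu> u u'"
    and "\<And>t. t \<in> J \<Longrightarrow> p t = q t" "\<And>t. t \<in> J \<Longrightarrow> v t = u t" "\<And>t. t \<in> J \<Longrightarrow> v' t = u' t"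
  shows "hill_solution_on J p \<mu> v v'"
  unfolding hill_solution_on_def
proof (intro conjI ballI)
  have tr: "(g has_real_derivative D) (at t within J)"
    if "(f has_real_derivative D) (at t within J)" "t \<in> J" "\<And>t. t \<in> J \<Longrightarrow> g t = f t" for f g D t
    using that by (intro has_field_derivative_transform_within[OF that(1), of 1]) auto
  show "(v has_real_derivative v' t) (at t within J)" if "t \<in> J" for t
    using assms that tr[of u "u' t" t v] unfolding hill_solution_on_def by simp
  show "continuous_on J v'"
    using assms unfolding hill_solution_on_def by (simp cong: continuous_on_cong)
  show "abs_continuous_on J v'"
    using assms unfolding hill_solution_on_def by (blast intro: abs_continuous_on_cong)
  have "AE t\<in>J in lebesgue. \<exists>u''. (u' has_real_derivative u'') (at t within J) \<and>
        u'' + (q t + \<mu>) * u t = 0"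
    using assms unfolding hill_solution_on_def by simp
  then show "AE t\<in>J in lebesgue. \<exists>v''. (v' has_real_derivative v'') (at t within J) \<and>
        v'' + (p t + \<mu>) * v t = 0"
    by eventually_elim (use assms(2-4) tr in metis)
qed

lemma hill_solution_on_add:
  assumes "hill_solution_on J q \<mu> u u'" "hill_solution_on J q \<mu> v v'"
  shows "hill_solution_on J q \<mu> (\<lambda>t. u t + v t) (\<lambda>t. u' t + v' t)"
  unfolding hill_solution_on_def
proof (intro conjI ballI)
  show "((\<lambda>t. u t + v t) has_real_derivative u' t + v' t) (at t within J)" if "t \<in> J" for t
    using assms that unfolding hill_solution_on_def by (blast intro: DERIV_add)
  show "continuous_on J (\<lambda>t. u' t + v' t)"
    using assms unfolding hill_solution_on_def by (blast intro: continuous_on_add)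
  show "abs_continuous_on J (\<lambda>t. u' t + v' t)"
    using assms unfolding hill_solution_on_def by (blast intro: abs_continuous_on_add)
  have "AE t\<in>J in lebesgue. \<exists>u''. (u' has_real_derivative u'') (at t within J) \<and>
        u'' + (q t + \<mu>) * u t = 0"
    "AE t\<in>J in lebesgue. \<exists>v''. (v' has_real_derivative v'') (at t within J) \<and>
        v'' + (q t + \<mu>) * v t = 0"
    using assms unfolding hill_solution_on_def by simp_all
  then show "AE t\<in>J in lebesgue. \<exists>w''. ((\<lambda>t. u' t + v' t) has_real_derivative w'') (at t within J) \<and>
        w'' + (q t + \<mu>) * (u t + v t) = 0"
  proof eventually_elim
    case (elim t)
    show ?case
    proof
      assume "t \<in> J"
      then obtain u'' v'' where
        "(u' has_real_derivative u'') (at t within J)" "u'' + (q t + \<mu>) * u t = 0"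
        "(v' has_real_derivative v'') (at t within J)" "v'' + (q t + \<mu>) * v t = 0"
        using elim by blast
      then show "\<exists>w''. ((\<lambda>t. u' t + v' t) has_real_derivative w'') (at t within J) \<and>
          w'' + (q t + \<mu>) * (u t + v t) = 0"
        by (intro exI[of _ "u'' + v''"]) (auto intro: DERIV_add simp: algebra_simps)
    qed
  qed
qed

lemma hill_solution_on_reflect:
  fixes m c :: real
  assumes "hill_solution_on {a..b} q \<mu> u u'"
  shows "hill_solution_on {m - b..m - a} (\<lambda>t. q (m - t)) \<mu> (\<lambda>t. c * u (m - t)) (\<lambda>t. - c * u' (m - t))"
  unfolding hill_solution_on_def
proof (intro conjI ballI)
  show "((\<lambda>t. c * u (m - t)) has_real_derivative - c * u' (m - t)) (at t within {m - b..m - a})"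
    if "t \<in> {m - b..m - a}" for t
    using assms that unfolding hill_solution_on_def by (intro has_real_derivative_reflect) auto
  have "continuous_on {a..b} u'"
    using assms unfolding hill_solution_on_def by blast
  then have "continuous_on {m - b..m - a} (\<lambda>t. u' (m - t))"
    by (rule continuous_on_compose2) (auto intro: continuous_on_diff)
  then show "continuous_on {m - b..m - a} (\<lambda>t. - c * u' (m - t))"
    by (rule continuous_on_mult_left)
  show "abs_continuous_on {m - b..m - a} (\<lambda>t. - c * u' (m - t))"
    using assms unfolding hill_solution_on_def by (intro abs_continuous_on_reflect) auto
  have "AE t\<in>{a..b} in lebesgue. \<exists>u''. (u' has_real_derivative u'') (at t within {a..b}) \<and>
        u'' + (q t + \<mu>) * u t = 0"
    using assms unfolding hill_solution_on_def by simp
  from AE_lebesgue_reflect[OF this, of m]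
  show "AE t\<in>{m - b..m - a} in lebesgue.
      \<exists>v''. ((\<lambda>t. - c * u' (m - t)) has_real_derivative v'') (at t within {m - b..m - a}) \<and>
        v'' + (q (m - t) + \<mu>) * (c * u (m - t)) = 0"
  proof eventually_elim
    case (elim t)
    show ?case
    proof
      assume "t \<in> {m - b..m - a}"
      then have "m - t \<in> {a..b}" by auto
      then obtain u'' where u'': "(u' has_real_derivative u'') (at (m - t) within {a..b})"
        "u'' + (q (m - t) + \<mu>) * u (m - t) = 0"
        using elim by blast
      have "c * u'' + (q (m - t) + \<mu>) * (c * u (m - t)) = c * (u'' + (q (m - t) + \<mu>) * u (m - t))"
        by (simp add: algebra_simps)
      with u'' has_real_derivative_reflect[OF u''(1), of "- c"]
      show "\<exists>v''. ((\<lambda>t. - c * u' (m - t)) has_real_derivative v'') (at t within {m - b..m - a}) \<and>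
          v'' + (q (m - t) + \<mu>) * (c * u (m - t)) = 0"
        by (intro exI[of _ "c * u''"]) simp
    qed
  qed
qed

lemma hill_solution_on_Un:
  assumes "hill_solution_on {a..b} q \<mu> u u'" "hill_solution_on {b..c} q \<mu> u u'" "a \<le> b" "b \<le> c"
  shows "hill_solution_on {a..c} q \<mu> u u'"
  unfolding hill_solution_on_def
proof (intro conjI ballI)
  have J: "{a..c} = {a..b} \<union> {b..c}"
    using assms(3,4) by auto
  show "(u has_real_derivative u' t) (at t within {a..c})" for t
    using assms(1,2) unfolding J hill_solution_on_def by (intro has_real_derivative_Un) auto
  show "continuous_on {a..c} u'"
    using assms(1,2) unfolding J hill_solution_on_def by (intro continuous_on_closed_Un) auto
  show "abs_continuous_on {a..c} u'"
    using assms unfolding hill_solution_on_def by (blast intro: abs_continuous_on_Un)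
  have "AE t in lebesgue. t \<noteq> b"
    by (rule AE_I'[of "{b}"]) (auto simp flip: negligible_iff_null_sets)
  moreover have
    "AE t\<in>{a..b} in lebesgue. \<exists>u''. (u' has_real_derivative u'') (at t within {a..b}) \<and>
        u'' + (q t + \<mu>) * u t = 0"
    "AE t\<in>{b..c} in lebesgue. \<exists>u''. (u' has_real_derivative u'') (at t within {b..c}) \<and>
        u'' + (q t + \<mu>) * u t = 0"
    using assms(1,2) unfolding hill_solution_on_def by simp_all
  ultimately show "AE t\<in>{a..c} in lebesgue. \<exists>u''. (u' has_real_derivative u'') (at t within {a..c}) \<and>
        u'' + (q t + \<mu>) * u t = 0"
  proof eventually_elim
    case (elim t)
    \<comment> \<open>Away from \<open>b\<close> only one of the two halves is seen near \<open>t\<close>; at \<open>b\<close> the one-sided second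
      derivatives may differ.\<close>
    have "t \<notin> {a..b} \<or> t \<notin> {b..c}"
      using elim(1) by auto
    with elim(2,3) has_real_derivative_Un[of t "{a..b}" u' _ "{b..c}"] show ?case
      unfolding J by (metis Un_iff closed_atLeastAtMost)
  qed
qed

section \<open>Symmetric and antisymmetric solutions\<close>

lemma even_ext_left: "t \<le> S \<Longrightarrow> even_ext S q t = q t"
  by (simp add: even_ext_def)

lemma even_ext_reflect: "even_ext S q (2 * S - t) = even_ext S q t"
  by (auto simp: even_ext_def)

text \<open>The even (\<open>c = 1\<close>) and odd (\<open>c = - 1\<close>) extensions are treated at once; the two hypotheses on
  the values at \<open>S\<close> are the \<open>C\<^sup>1\<close> matching conditions, \<open>u' S = 0\<close> or \<open>u S = 0\<close> respectively.\<close>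

lemma hill_solution_extend:
  fixes c :: real
  assumes "S > 0" "hill_solution q S \<mu> u u'" "c * u S = u S" "- c * u' S = u' S"
  defines "v \<equiv> \<lambda>t. if t \<le> S then u t else c * u (2 * S - t)"
    and "v' \<equiv> \<lambda>t. if t \<le> S then u' t else - c * u' (2 * S - t)"
  shows "hill_solution (even_ext S q) (2 * S) \<mu> v v'"
proof -
  have u: "hill_solution_on {0..S} q \<mu> u u'"
    using assms(2) by (simp add: hill_solution_iff_on)
  have "hill_solution_on {0..S} (even_ext S q) \<mu> v v'"
    by (rule hill_solution_on_cong[OF u]) (auto simp: even_ext_def v_def v'_def)
  moreover have "hill_solution_on {S..2 * S} (even_ext S q) \<mu> v v'"
  proof (rule hill_solution_on_cong)
    show "hill_solution_on {S..2 * S} (\<lambda>t. q (2 * S - t)) \<mu>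
        (\<lambda>t. c * u (2 * S - t)) (\<lambda>t. - c * u' (2 * S - t))"
      using hill_solution_on_reflect[OF u, of "2 * S" c] by simp
    fix t assume "t \<in> {S..2 * S}"
    then show "even_ext S q t = q (2 * S - t)" "v t = c * u (2 * S - t)" "v' t = - c * u' (2 * S - t)"
      using assms(3,4) by (cases "t = S"; simp add: even_ext_def v_def v'_def)+
  qed
  ultimately show ?thesis
    unfolding hill_solution_iff_on by (rule hill_solution_on_Un) (use \<open>S > 0\<close> in auto)
qed

lemma spectrumI:
  assumes "hill_solution q S \<mu> u u'" "boundary_condition B S u u'" "t \<in> {0..S}" "u t \<noteq> 0"
  shows "\<mu> \<in> spectrum B q S"
  using assms unfolding spectrum_def by blast

lemma spectrumE:
  assumes "\<mu> \<in> spectrum B q S"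
  obtains u u' t where "hill_solution q S \<mu> u u'" "boundary_condition B S u u'" "t \<in> {0..S}" "u t \<noteq> 0"
  using assms unfolding spectrum_def by blast

lemma spectrum_Neumann_subset:
  assumes "S > 0"
  shows "spectrum Neumann q S \<subseteq>
    spectrum Periodic (even_ext S q) (2 * S) \<inter> spectrum Neumann (even_ext S q) (2 * S)"
proof
  fix \<mu> assume "\<mu> \<in> spectrum Neumann q S"
  then obtain u u' t where u: "hill_solution q S \<mu> u u'" "u' 0 = 0" "u' S = 0" "t \<in> {0..S}" "u t \<noteq> 0"
    by (auto elim: spectrumE)
  have *: "hill_solution (even_ext S q) (2 * S) \<mu> (\<lambda>t. if t \<le> S then u t else 1 * u (2 * S - t))
      (\<lambda>t. if t \<le> S then u' t else - 1 * u' (2 * S - t))"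
    using u assms by (intro hill_solution_extend) auto
  show "\<mu> \<in> spectrum Periodic (even_ext S q) (2 * S) \<inter> spectrum Neumann (even_ext S q) (2 * S)"
    by (intro IntI spectrumI[OF *, where t = t]) (use u assms in auto)
qed

lemma spectrum_Dirichlet_subset:
  assumes "S > 0"
  shows "spectrum Dirichlet q S \<subseteq>
    spectrum Periodic (even_ext S q) (2 * S) \<inter> spectrum Dirichlet (even_ext S q) (2 * S)"
proof
  fix \<mu> assume "\<mu> \<in> spectrum Dirichlet q S"
  then obtain u u' t where u: "hill_solution q S \<mu> u u'" "u 0 = 0" "u S = 0" "t \<in> {0..S}" "u t \<noteq> 0"
    by (auto elim: spectrumE)
  have *: "hill_solution (even_ext S q) (2 * S) \<mu> (\<lambda>t. if t \<le> S then u t else - 1 * u (2 * S - t))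
      (\<lambda>t. if t \<le> S then u' t else - (- 1) * u' (2 * S - t))"
    using u assms by (intro hill_solution_extend) auto
  show "\<mu> \<in> spectrum Periodic (even_ext S q) (2 * S) \<inter> spectrum Dirichlet (even_ext S q) (2 * S)"
    by (intro IntI spectrumI[OF *, where t = t]) (use u assms in auto)
qed

text \<open>The reflected function solves the same equation because the coefficient is even about \<open>S\<close>, and
  the equation is linear. The cases used are the symmetric part (\<open>c = 1\<close>), whose derivative
  vanishes at \<open>S\<close>, and the antisymmetric part (\<open>c = - 1\<close>), which itself vanishes at \<open>S\<close>.\<close>

lemma hill_solution_symmetrize:
  fixes c :: real
  assumes "S > 0" "hill_solution (even_ext S q) (2 * S) \<mu> u u'"
  shows "hill_solution q S \<mu> (\<lambda>t. u t + c * u (2 * S - t)) (\<lambda>t. u' t + - c * u' (2 * S - t))"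
proof -
  have u: "hill_solution_on {0..2 * S} (even_ext S q) \<mu> u u'"
    using assms(2) by (simp add: hill_solution_iff_on)
  have "hill_solution_on {0..2 * S} (even_ext S q) \<mu> (\<lambda>t. c * u (2 * S - t)) (\<lambda>t. - c * u' (2 * S - t))"
    using hill_solution_on_reflect[OF u, of "2 * S" c] by (simp add: even_ext_reflect)
  from hill_solution_on_add[OF u this]
  have "hill_solution_on {0..S} (even_ext S q) \<mu>
      (\<lambda>t. u t + c * u (2 * S - t)) (\<lambda>t. u' t + - c * u' (2 * S - t))"
    by (rule hill_solution_on_subset) (use assms(1) in auto)
  then show ?thesis
    unfolding hill_solution_iff_on
    by (rule hill_solution_on_cong) (simp_all add: even_ext_left)
qed

lemma spectrum_Periodic_subset:
  assumes "S > 0"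
  shows "spectrum Periodic (even_ext S q) (2 * S) \<subseteq> spectrum Neumann q S \<union> spectrum Dirichlet q S"
proof
  fix \<mu> assume "\<mu> \<in> spectrum Periodic (even_ext S q) (2 * S)"
  then obtain u u' t where u: "hill_solution (even_ext S q) (2 * S) \<mu> u u'"
      "u 0 = u (2 * S)" "u' 0 = u' (2 * S)" "t \<in> {0..2 * S}" "u t \<noteq> 0"
    by (auto elim: spectrumE)
  \<comment> \<open>The (anti)symmetric parts are known on the left half only, so the point where \<open>u\<close> does not
    vanish is moved there.\<close>
  define s where "s = (if t \<le> S then t else 2 * S - t)"
  have s: "s \<in> {0..S}" "u s \<noteq> 0 \<or> u (2 * S - s) \<noteq> 0"
    using u(4,5) by (auto simp: s_def)
  show "\<mu> \<in> spectrum Neumann q S \<union> spectrum Dirichlet q S"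
  proof (cases "u s + 1 * u (2 * S - s) = 0")
    case False
    have "\<mu> \<in> spectrum Neumann q S"
      by (rule spectrumI[where t = s, OF hill_solution_symmetrize[OF assms u(1), of 1]])
        (use u(3) s(1) False in auto)
    then show ?thesis ..
  next
    case True
    then have "u s + - 1 * u (2 * S - s) \<noteq> 0"
      using s(2) by auto
    then have "\<mu> \<in> spectrum Dirichlet q S"
      by (intro spectrumI[where t = s, OF hill_solution_symmetrize[OF assms u(1), of "- 1"]])
        (use u(2) s(1) in auto)
    then show ?thesis ..
  qed
qed

lemma spectrum_Periodic_even_ext:
  assumes "S > 0"
  shows "spectrum Neumann q S \<union> spectrum Dirichlet q S = spectrum Periodic (even_ext S q) (2 * S)"
  using spectrum_Neumann_subset[OF assms, of q] spectrum_Dirichlet_subset[OF assms, of q]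
    spectrum_Periodic_subset[OF assms, of q] by blast

theorem mainTheorem5:
  fixes T :: real and a :: "real \<Rightarrow> real"
  assumes "T > 0" and "a absolutely_integrable_on {0..T}"
  shows "spectrum Neumann a T \<union> spectrum Dirichlet a T
        = spectrum Periodic (even_ext T a) (2 * T)
    \<and> spectrum Neumann a T \<subseteq> spectrum Neumann (even_ext T a) (2 * T)
    \<and> spectrum Dirichlet a T \<subseteq> spectrum Dirichlet (even_ext T a) (2 * T)
    \<and> spectrum Neumann a T \<union> spectrum Dirichlet a T
        \<subseteq> spectrum Neumann (even_ext T a) (2 * T) \<union> spectrum Dirichlet (even_ext T a) (2 * T)
    \<and> spectrum Neumann (even_ext T a) (2 * T) \<union> spectrum Dirichlet (even_ext T a) (2 * T)
        = spectrum Periodic (even_ext (2 * T) (even_ext T a)) (4 * T)"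
proof -
  have "2 * T > 0" using \<open>T > 0\<close> by simp
  from spectrum_Periodic_even_ext[OF this, of "even_ext T a"]
  have "spectrum Neumann (even_ext T a) (2 * T) \<union> spectrum Dirichlet (even_ext T a) (2 * T)
      = spectrum Periodic (even_ext (2 * T) (even_ext T a)) (4 * T)"
    by simp
  with spectrum_Periodic_even_ext[OF \<open>T > 0\<close>, of a] spectrum_Neumann_subset[OF \<open>T > 0\<close>, of a]
    spectrum_Dirichlet_subset[OF \<open>T > 0\<close>, of a]
  show ?thesis by blast
qed

end
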